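(* Let $G$ be a structured bilinear SISO system given by $\mathcal{C},\mathcal{K},\mathcal{N},\mathcal{B}$, with subsystem transfer functions $G_k$, and let $\widehat G$, with subsystem transfer functions $\widehat G_k$, be the reduced-order bilinear SISO system constructed by projection with $W,V\in\mathbb{C}^{n\times r}$. Let $\sigma_1,\ldots,\sigma_k\in\mathbb{C}$ be interpolation points at which the matrix functions $\mathcal{C}(s)$, $\mathcal{K}(s)^{-1}$, $\mathcal{N}(s)$ and $\mathcal{B}(s)$ are defined and $\widehat{\mathcal{K}}(s)$ is full-rank. Let \[ w_1=\mathcal{K}(\sigma_k)^{-\mathsf H}\mathcal{C}(\sigma_k)^{\mathsf H},\qquad w_j=\mathcal{K}(\sigma_{k-j+1})^{-\mathsf H}\mathcal{N}(\sigma_{k-j+1})^{\mathsf H}w_{j-1},\quad 2\le j\le k, \] let $W$ be such that $\operatorname{span}(W)\supseteq\operatorname{span}([w_1,\ldots,w_k])$, and let $V$ be an arbitrary full-rank truncation matrix of appropriate dimension. Then \[ G_1(\sigma_k)=\widehat G_1(\sigma_k),\quad G_2(\sigma_{k-1},\sigma_k)=\widehat G_2(\sigma_{k-1},\sigma_k),\quad\ldots,\quad G_k(\sigma_1,\ldots,\sigma_k)=\widehat G_k(\sigma_1,\ldots,\sigma_k). \]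
   Context: A structured bilinear SISO (single-input single-output) system $G$ is described by matrix-valued functions of a complex variable $\mathcal{C}\colon\mathbb{C}\to\mathbb{C}^{1\times n}$, $\mathcal{K}\colon\mathbb{C}\to\mathbb{C}^{n\times n}$, $\mathcal{N}\colon\mathbb{C}\to\mathbb{C}^{n\times n}$, $\mathcal{B}\colon\mathbb{C}\to\mathbb{C}^{n\times 1}$ (which may fail to be defined, or $\mathcal{K}$ may fail to be invertible, at some points), through its regular subsystem transfer functions \[ G_k(s_1,\ldots,s_k)=\mathcal{C}(s_k)\mathcal{K}(s_k)^{-1}\Big(\prod_{j=1}^{k-1}\mathcal{N}(s_{k-j})\mathcal{K}(s_{k-j})^{-1}\Big)\mathcal{B}(s_1),\qquad k\ge 1 . \] Products $\prod_{j=1}^{m}A_j$ of matrices are ordered $A_1A_2\cdots A_m$; empty products are identities. Given model reduction bases (truncation matrices) $W,V\in\mathbb{C}^{n\times r}$, the reduced-order system $\widehat G$ is given by \[ \widehat{\mathcal{C}}(s)=\mathcal{C}(s)V,\quad \widehat{\mathcal{K}}(s)=W^{\mathsf H}\mathcal{K}(s)V,\quad \widehat{\mathcal{B}}(s)=W^{\mathsf H}\mathcal{B}(s),\quad \widehat{\mathcal{N}}(s)=W^{\mathsf H}\mathcal{N}(s)V, \] and its transfer functions $\widehat G_k$ are defined by the same formula with hatted quantities. Here $^{\mathsf H}$ is the conjugate transpose, $^{-\mathsf H}$ the conjugate transpose of the inverse, and $\operatorname{span}$ of a matrix is its column space. *)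

theory Defs
  imports "HOL-Analysis.Analysis"
begin

text \<open>
  The four coefficient functions are partial (type \<open>option\<close>), since they need not be
  defined on the whole complex plane. Row and column vectors are kept as \<open>1 \<times> n\<close> and
  \<open>n \<times> 1\<close> matrices; note that \<open>complex^'c^'r\<close> is the type of matrices with rows
  indexed by \<open>'r\<close> and columns indexed by \<open>'c\<close>.
\<close>

record 'n bilinear_system =
  C_fun :: "complex \<rightharpoonup> complex^'n^1"
  K_fun :: "complex \<rightharpoonup> complex^'n^'n"
  N_fun :: "complex \<rightharpoonup> complex^'n^'n"
  B_fun :: "complex \<rightharpoonup> complex^1^'n"

text \<open>Values of the coefficient functions, meaningful only where these are defined.\<close>

abbreviation C_at :: "('n::finite) bilinear_system \<Rightarrow> complex \<Rightarrow> complex^'n^1"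
  where "C_at G s \<equiv> the (C_fun G s)"

abbreviation K_at :: "('n::finite) bilinear_system \<Rightarrow> complex \<Rightarrow> complex^'n^'n"
  where "K_at G s \<equiv> the (K_fun G s)"

abbreviation N_at :: "('n::finite) bilinear_system \<Rightarrow> complex \<Rightarrow> complex^'n^'n"
  where "N_at G s \<equiv> the (N_fun G s)"

abbreviation B_at :: "('n::finite) bilinear_system \<Rightarrow> complex \<Rightarrow> complex^1^'n"
  where "B_at G s \<equiv> the (B_fun G s)"

definition conj_transpose :: "complex^'c^'r \<Rightarrow> complex^'r^'c"
  where "conj_transpose A = (\<chi> i j. cnj (A $ j $ i))"

definition full_rank :: "complex^'c^'r \<Rightarrow> bool"
  where "full_rank A \<longleftrightarrow> rank A = min CARD('r) CARD('c)"

text \<open>The ordered product \<open>A 1 ** A 2 ** \<dots> ** A m\<close>.\<close>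

primrec mat_prod :: "(nat \<Rightarrow> complex^'n^'n) \<Rightarrow> nat \<Rightarrow> complex^'n^'n"
  where
    "mat_prod A 0 = mat 1"
  | "mat_prod A (Suc m) = mat_prod A m ** A (Suc m)"

text \<open>
  The \<open>k\<close>-th regular subsystem transfer function for \<open>k \<ge> 1\<close>. Its arguments are the
  values \<open>s 1, \<dots>, s k\<close>; no other values of \<open>s\<close> are used.
\<close>

definition transfer_fun ::
    "('n::finite) bilinear_system \<Rightarrow> nat \<Rightarrow> (nat \<Rightarrow> complex) \<Rightarrow> complex^1^1"
  where
    "transfer_fun G k s =
       C_at G (s k) ** matrix_inv (K_at G (s k))
       ** mat_prod (\<lambda>j. N_at G (s (k - j)) ** matrix_inv (K_at G (s (k - j)))) (k - 1)
       ** B_at G (s 1)"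

definition reduced_system ::
    "('n::finite) bilinear_system \<Rightarrow> complex^'r^'n \<Rightarrow> complex^'r^'n
      \<Rightarrow> ('r::finite) bilinear_system"
  where
    "reduced_system G W V =
       \<lparr> C_fun = (\<lambda>s. map_option (\<lambda>C. C ** V) (C_fun G s)),
         K_fun = (\<lambda>s. map_option (\<lambda>K. conj_transpose W ** K ** V) (K_fun G s)),
         N_fun = (\<lambda>s. map_option (\<lambda>N. conj_transpose W ** N ** V) (N_fun G s)),
         B_fun = (\<lambda>s. map_option (\<lambda>B. conj_transpose W ** B) (B_fun G s)) \<rparr>"

end

theory Submission
  imports Defs
begin

text \<open>
  The row vectors \<open>u j\<close> with \<open>G\<^sub>j = u j ** B\<close> are the conjugate transposes of \<open>w j\<close>, hence
  \<open>u j = y ** W\<^sup>H\<close> for some row \<open>y\<close>. Induction on \<open>j\<close> shows that \<open>y\<close> is the corresponding row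
  of the reduced system, because
  \<open>u (j - 1) ** N ** V = u j ** K ** V = y ** (W\<^sup>H ** K ** V)\<close> and the reduced \<open>K\<close> cancels.
\<close>

lemma conj_transpose_mult: "conj_transpose (A ** B) = conj_transpose B ** conj_transpose A"
  by (simp add: conj_transpose_def matrix_matrix_mult_def vec_eq_iff mult.commute)

lemma conj_transpose_conj_transpose [simp]: "conj_transpose (conj_transpose A) = A"
  by (simp add: conj_transpose_def vec_eq_iff)

lemma matrix_inv_right_inverse: "invertible A \<Longrightarrow> A ** matrix_inv A = mat 1"
  and matrix_inv_left_inverse: "invertible A \<Longrightarrow> matrix_inv A ** A = mat 1"
  unfolding invertible_def matrix_inv_def by (metis (mono_tags, lifting) someI_ex)+

text \<open>Rows of a square matrix of full rank span the whole space, which gives a left inverse.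
  This turns the rank hypothesis on the reduced \<open>K\<close> into the right to cancel
  it.\<close>

lemma full_rank_imp_invertible:
  fixes A :: "complex^'n^'n"
  assumes "full_rank A"
  shows "invertible A"
proof -
  have "vec.dim (rows A) = CARD('n)"
    using assms by (simp add: full_rank_def row_rank_def_gen)
  then have "vec.span (rows A) = UNIV"
    using vec.dim_eq_span [of "rows A" UNIV] by (simp add: card_cart_basis)
  then show ?thesis
    by (simp add: invertible_left_inverse matrix_left_invertible_span_rows_gen)
qed

lemma span_columns_subset_range: "vec.span (columns A) \<subseteq> range ((*v) A)"
proof (rule vec.span_minimal)
  have "column i A = A *v axis i 1" for i
    by (simp add: vec_eq_iff column_def matrix_vector_mult_def axis_def if_distrib cong: if_cong)
  then show "columns A \<subseteq> range ((*v) A)"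
    by (auto simp: columns_def)
  show "vec.subspace (range ((*v) A))"
    by (rule vec.subspace_image) simp_all
qed

text \<open>Turns the span hypothesis on \<open>W\<close> into a matrix equation: column
  \<open>j\<close> of \<open>X\<close> collects the coefficients that express column
  \<open>j\<close> of \<open>A\<close> through the columns of \<open>W\<close>.\<close>

lemma columns_in_span_imp_factor:
  assumes "columns A \<subseteq> vec.span (columns W)"
  obtains X where "A = W ** X"
proof -
  have "\<exists>x. column i A = W *v x" for i
    using assms span_columns_subset_range [of W] by (fastforce simp: columns_def)
  then obtain x where x: "\<And>i. column i A = W *v x i"
    by metis
  have "A = W ** (\<chi> i j. x j $ i)"
    using x by (simp add: vec_eq_iff column_def matrix_matrix_mult_def matrix_vector_mult_def)
  then show thesis
    by (rule that)
qed

lemma mat_prod_cong: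
  "(\<And>j. 1 \<le> j \<Longrightarrow> j \<le> m \<Longrightarrow> A j = B j) \<Longrightarrow> mat_prod A m = mat_prod B m"
  by (induction m) auto

text \<open>This is the row \<open>u j\<close> of the overview. The points are read backwards from
  \<open>s k\<close>, with \<open>k\<close> fixed, so that raising \<open>j\<close> only appends a
  factor on the right.\<close>

definition left_row ::
    "('n::finite) bilinear_system \<Rightarrow> (nat \<Rightarrow> complex) \<Rightarrow> nat \<Rightarrow> nat \<Rightarrow> complex^'n^1"
  where
    "left_row G s k j =
       C_at G (s k) ** matrix_inv (K_at G (s k))
       ** mat_prod (\<lambda>i. N_at G (s (k - i)) ** matrix_inv (K_at G (s (k - i)))) (j - 1)"

lemma left_row_1: "left_row G s k 1 = C_at G (s k) ** matrix_inv (K_at G (s k))"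
  by (simp add: left_row_def)

text \<open>The case \<open>j = 0\<close> must be excluded: by truncated subtraction, rows
  \<open>0\<close> and \<open>1\<close> are the same.\<close>

lemma left_row_Suc:
  assumes "j \<ge> 1"
  shows "left_row G s k (Suc j) =
    left_row G s k j ** (N_at G (s (k - j)) ** matrix_inv (K_at G (s (k - j))))"
  using assms by (cases j) (simp_all add: left_row_def matrix_mul_assoc)

text \<open>The shift sends argument \<open>j\<close> to \<open>s k\<close> and argument
  \<open>1\<close> to \<open>s (k - j + 1)\<close>. Inside the product
  \<open>k - j + (j - i) = k - i\<close>, as \<open>i\<close> stays below \<open>j\<close>.\<close>

lemma transfer_fun_shift:
  assumes "1 \<le> j" "j \<le> k"
  shows "transfer_fun G j (\<lambda>i. s (k - j + i)) = left_row G s k j ** B_at G (s (k - j + 1))"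
proof -
  have "mat_prod (\<lambda>i. N_at G (s (k - j + (j - i))) ** matrix_inv (K_at G (s (k - j + (j - i))))) (j - 1)
      = mat_prod (\<lambda>i. N_at G (s (k - i)) ** matrix_inv (K_at G (s (k - i)))) (j - 1)"
    using assms by (intro mat_prod_cong) simp
  moreover have "k - j + j = k"
    using assms by simp
  ultimately show ?thesis
    by (simp only: transfer_fun_def left_row_def)
qed

lemma reduced_system_at:
  "s \<in> dom (C_fun G) \<Longrightarrow> C_at (reduced_system G W V) s = C_at G s ** V"
  "s \<in> dom (K_fun G) \<Longrightarrow> K_at (reduced_system G W V) s = conj_transpose W ** K_at G s ** V"
  "s \<in> dom (N_fun G) \<Longrightarrow> N_at (reduced_system G W V) s = conj_transpose W ** N_at G s ** V"
  "s \<in> dom (B_fun G) \<Longrightarrow> B_at (reduced_system G W V) s = conj_transpose W ** B_at G s"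
  by (auto simp: reduced_system_def)

text \<open>Inserting \<open>matrix_inv K ** K\<close> after \<open>c\<close> gives
  \<open>c ** V = y ** (conj_transpose W ** K ** V)\<close>. It serves both induction cases:
  \<open>c\<close> is the output row \<open>C\<close> in the first and a row times \<open>N\<close>
  in the second.\<close>

lemma projected_row_eq:
  fixes c :: "complex^'n^'m" and K :: "complex^'n^'n" and W V :: "complex^'r^'n"
  assumes "invertible K" and "invertible (conj_transpose W ** K ** V)"
    and fac: "c ** matrix_inv K = y ** conj_transpose W"
  shows "c ** V ** matrix_inv (conj_transpose W ** K ** V) = y"
proof -
  let ?Kr = "conj_transpose W ** K ** V"
  have "c ** V = c ** (matrix_inv K ** K) ** V"
    using assms(1) by (simp add: matrix_inv_left_inverse)
  also have "\<dots> = (c ** matrix_inv K) ** K ** V"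
    by (simp add: matrix_mul_assoc)
  also have "\<dots> = y ** ?Kr"
    by (simp add: fac matrix_mul_assoc)
  finally have "c ** V ** matrix_inv ?Kr = y ** (?Kr ** matrix_inv ?Kr)"
    by (simp add: matrix_mul_assoc)
  then show ?thesis
    using assms(2) by (simp add: matrix_inv_right_inverse)
qed

theorem theorem2:
  fixes G :: "('n::finite) bilinear_system"
    and W V :: "complex^('r::finite)^'n"
    and k :: nat
    and \<sigma> :: "nat \<Rightarrow> complex"
    and w :: "nat \<Rightarrow> complex^1^'n"
  assumes "k \<ge> 1"
    and "\<forall>i\<in>{1..k}. \<sigma> i \<in> dom (C_fun G)"
    and "\<forall>i\<in>{1..k}. \<sigma> i \<in> dom (K_fun G) \<and> invertible (K_at G (\<sigma> i))"
    and "\<forall>i\<in>{1..k}. \<sigma> i \<in> dom (N_fun G)"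
    and "\<forall>i\<in>{1..k}. \<sigma> i \<in> dom (B_fun G)"
    and "\<forall>i\<in>{1..k}. full_rank (K_at (reduced_system G W V) (\<sigma> i))"
    and "w 1 = conj_transpose (matrix_inv (K_at G (\<sigma> k))) ** conj_transpose (C_at G (\<sigma> k))"
    and "\<forall>j\<in>{2..k}. w j =
           conj_transpose (matrix_inv (K_at G (\<sigma> (k - j + 1))))
           ** conj_transpose (N_at G (\<sigma> (k - j + 1))) ** w (j - 1)"
    and "vec.span (columns W) \<supseteq> vec.span (\<Union>j\<in>{1..k}. columns (w j))"
    and "full_rank V"
  shows "\<forall>j\<in>{1..k}.
           transfer_fun G j (\<lambda>i. \<sigma> (k - j + i)) =
           transfer_fun (reduced_system G W V) j (\<lambda>i. \<sigma> (k - j + i))"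
proof -
  let ?R = "reduced_system G W V"
  have Kinv: "invertible (K_at G (\<sigma> i))" and KRinv: "invertible (K_at ?R (\<sigma> i))"
    and at: "C_at ?R (\<sigma> i) = C_at G (\<sigma> i) ** V"
      "K_at ?R (\<sigma> i) = conj_transpose W ** K_at G (\<sigma> i) ** V"
      "N_at ?R (\<sigma> i) = conj_transpose W ** N_at G (\<sigma> i) ** V"
      "B_at ?R (\<sigma> i) = conj_transpose W ** B_at G (\<sigma> i)"
    if "1 \<le> i" "i \<le> k" for i
    using assms(2-6) that by (simp_all add: reduced_system_at full_rank_imp_invertible)
  \<comment> \<open>Conjugate transposition reverses products, so the left recursion for
    \<open>w\<close> becomes the right recursion for \<open>left_row\<close>.\<close>
  have w_row: "conj_transpose (w j) = left_row G \<sigma> k j" if "1 \<le> j" "j \<le> k" for j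
    using that
  proof (induction j rule: dec_induct)
    case base
    show ?case
      by (simp only: assms(7) left_row_1 conj_transpose_mult conj_transpose_conj_transpose)
  next
    case (step j)
    \<comment> \<open>Here \<open>k - Suc j + 1 = k - j\<close> because
      \<open>j < k\<close>.\<close>
    have "w (Suc j) = conj_transpose (matrix_inv (K_at G (\<sigma> (k - j))))
           ** conj_transpose (N_at G (\<sigma> (k - j))) ** w j"
      using assms(8) [rule_format, of "Suc j"] step by (simp add: Suc_diff_Suc)
    then show ?case
      using step by (simp add: conj_transpose_mult left_row_Suc)
  qed
  have factor: "\<exists>y. left_row G \<sigma> k j = y ** conj_transpose W" if "1 \<le> j" "j \<le> k" for j
  proof -
    have "columns (w j) \<subseteq> vec.span (\<Union>j\<in>{1..k}. columns (w j))"
      using that by (intro subsetI vec.span_base UN_I) simp_all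
    \<comment> \<open>The row sought is \<open>conj_transpose X\<close>.\<close>
    then obtain X where "w j = W ** X"
      using assms(9) by (meson columns_in_span_imp_factor order_trans)
    then show ?thesis
      using w_row [OF that] by (metis conj_transpose_mult)
  qed
  have row: "left_row G \<sigma> k j = left_row ?R \<sigma> k j ** conj_transpose W" if "1 \<le> j" "j \<le> k" for j
    using that
  proof (induction j rule: dec_induct)
    case base
    obtain y where y: "left_row G \<sigma> k 1 = y ** conj_transpose W"
      using factor [of 1] assms(1) by auto
    have "left_row ?R \<sigma> k 1 = y"
      unfolding left_row_1 at [OF assms(1) order_refl]
      using y Kinv [OF assms(1) order_refl] KRinv [OF assms(1) order_refl]
      by (intro projected_row_eq) (simp_all only: left_row_1 at [OF assms(1) order_refl])
    then show ?case
      using y by simp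
  next
    case (step j)
    have i: "1 \<le> k - j" "k - j \<le> k"
      using step by auto
    obtain y where y: "left_row G \<sigma> k (Suc j) = y ** conj_transpose W"
      using factor [of "Suc j"] step by auto
    have IH: "left_row G \<sigma> k j = left_row ?R \<sigma> k j ** conj_transpose W"
      using step by simp
    have "left_row ?R \<sigma> k (Suc j) = left_row ?R \<sigma> k j ** conj_transpose W ** N_at G (\<sigma> (k - j)) ** V
        ** matrix_inv (conj_transpose W ** K_at G (\<sigma> (k - j)) ** V)"
      using step by (simp add: left_row_Suc at [OF i] matrix_mul_assoc)
    also have "\<dots> = y"
    \<comment> \<open>Take \<open>c = left_row ?R \<sigma> k j ** conj_transpose W ** N_at G
      (\<sigma> (k - j))\<close>. By \<open>IH\<close> this is the full row times \<open>N\<close>,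
      so \<open>c\<close> times the inverse of \<open>K\<close> is the next full row.\<close>
    proof (rule projected_row_eq)
      show "left_row ?R \<sigma> k j ** conj_transpose W ** N_at G (\<sigma> (k - j))
          ** matrix_inv (K_at G (\<sigma> (k - j))) = y ** conj_transpose W"
        using y by (simp only: left_row_Suc [OF step(1)] matrix_mul_assoc IH)
    qed (use Kinv [OF i] KRinv [OF i] at [OF i] in simp_all)
    finally show ?case
      using y by simp
  qed
  show ?thesis
  proof
    fix j assume "j \<in> {1..k}"
    then have j: "1 \<le> j" "j \<le> k" and i: "1 \<le> k - j + 1" "k - j + 1 \<le> k"
      by auto
    \<comment> \<open>The factor \<open>conj_transpose W\<close> left over in \<open>row\<close> is
      absorbed by \<open>B\<close>, giving the reduced \<open>B\<close>.\<close>
    show "transfer_fun G j (\<lambda>i. \<sigma> (k - j + i)) = transfer_fun ?R j (\<lambda>i. \<sigma> (k - j + i))"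
      by (simp only: transfer_fun_shift [OF j] row [OF j] at [OF i] matrix_mul_assoc)
  qed
qed

end
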